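(* For each nonnegative integer $s$ and each positive integer $b$, $\tau_{s}(s+2,b) = 1$ if and only if $(s+2)^{s+2} \leq b \leq \binom{s+3}{2}(s+3)^{s+1}-1$.
   Context: All graphs are finite and simple. For graphs $G,H$ on disjoint vertex sets, the join $G \vee H$ is the graph consisting of $G$, $H$, and all edges joining a vertex of $G$ to a vertex of $H$; $K_n$ is the complete graph on $n$ vertices, and $K_0 \vee G$ is understood as $G$. $K_{a,b}$ is the complete bipartite graph with partite sets of sizes $a$ and $b$. $\chi$ denotes chromatic number and $\chi_\ell$ list chromatic number. For a nonnegative integer $s$ and positive integers $a,b$, $\tau_s(a,b)$ denotes the smallest nonnegative integer $n$ such that $\chi_\ell(K_n \vee K_{a,b}) - \chi(K_n \vee K_{a,b}) \leq s$. *)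

theory Defs
  imports Main
begin

record 'a graph =
  verts :: "'a set"
  adj :: "'a \<Rightarrow> 'a \<Rightarrow> bool"

definition simple_graph :: "'a graph \<Rightarrow> bool" where
  "simple_graph G \<longleftrightarrow>
     finite (verts G) \<and>
     (\<forall>u v. adj G u v \<longrightarrow> u \<in> verts G \<and> v \<in> verts G) \<and>
     (\<forall>u v. adj G u v \<longrightarrow> adj G v u) \<and>
     (\<forall>u. \<not> adj G u u)"

definition complete_graph :: "nat \<Rightarrow> nat graph" where
  "complete_graph n =
     \<lparr>verts = {..<n}, adj = (\<lambda>u v. u < n \<and> v < n \<and> u \<noteq> v)\<rparr>"

definition complete_bipartite :: "nat \<Rightarrow> nat \<Rightarrow> (nat + nat) graph" where
  "complete_bipartite a b =
     \<lparr>verts = {..<a} <+> {..<b},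
      adj = (\<lambda>u v. case (u, v) of
               (Inl i, Inr j) \<Rightarrow> i < a \<and> j < b
             | (Inr j, Inl i) \<Rightarrow> i < a \<and> j < b
             | _ \<Rightarrow> False)\<rparr>"

(* The sum type makes the two vertex sets disjoint. If G has no vertices, the join is
   the copy of H on the right summand. *)
definition join :: "'a graph \<Rightarrow> 'b graph \<Rightarrow> ('a + 'b) graph" where
  "join G H =
     \<lparr>verts = verts G <+> verts H,
      adj = (\<lambda>u v. case (u, v) of
               (Inl x, Inl y) \<Rightarrow> adj G x y
             | (Inr x, Inr y) \<Rightarrow> adj H x y
             | (Inl x, Inr y) \<Rightarrow> x \<in> verts G \<and> y \<in> verts H
             | (Inr y, Inl x) \<Rightarrow> x \<in> verts G \<and> y \<in> verts H)\<rparr>"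

definition proper_coloring :: "'a graph \<Rightarrow> ('a \<Rightarrow> nat) \<Rightarrow> bool" where
  "proper_coloring G c \<longleftrightarrow>
     (\<forall>u\<in>verts G. \<forall>v\<in>verts G. adj G u v \<longrightarrow> c u \<noteq> c v)"

definition colorable :: "'a graph \<Rightarrow> nat \<Rightarrow> bool" where
  "colorable G k \<longleftrightarrow> (\<exists>c. proper_coloring G c \<and> c ` verts G \<subseteq> {..<k})"

definition chromatic_number :: "'a graph \<Rightarrow> nat" where
  "chromatic_number G = (LEAST k. colorable G k)"

(* Colours are natural numbers without loss of generality: the lists of a finite graph
   involve finitely many colours. Finiteness is explicit because infinite sets have
   cardinality 0. *)
definition choosable :: "'a graph \<Rightarrow> nat \<Rightarrow> bool" where
  "choosable G k \<longleftrightarrow>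
     (\<forall>L. (\<forall>v\<in>verts G. finite (L v) \<and> card (L v) = k) \<longrightarrow>
          (\<exists>c. proper_coloring G c \<and> (\<forall>v\<in>verts G. c v \<in> L v)))"

definition list_chromatic_number :: "'a graph \<Rightarrow> nat" where
  "list_chromatic_number G = (LEAST k. choosable G k)"

definition tau :: "nat \<Rightarrow> nat \<Rightarrow> nat \<Rightarrow> nat" where
  "tau s a b =
     (LEAST n. int (list_chromatic_number (join (complete_graph n) (complete_bipartite a b)))
             - int (chromatic_number (join (complete_graph n) (complete_bipartite a b)))
             \<le> int s)"

lemma simple_graph_complete_graph: "simple_graph (complete_graph n)"
  by (auto simp: simple_graph_def complete_graph_def)

lemma simple_graph_complete_bipartite: "simple_graph (complete_bipartite a b)"
  by (auto simp: simple_graph_def complete_bipartite_def split: sum.splits)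

lemma simple_graph_join:
  "simple_graph G \<Longrightarrow> simple_graph H \<Longrightarrow> simple_graph (join G H)"
  by (auto simp: simple_graph_def join_def split: sum.splits)

lemma proper_coloring_join_empty:
  assumes "verts G = {}"
  shows "proper_coloring (join G H) c \<longleftrightarrow> proper_coloring H (c \<circ> Inr)"
proof -
  have "verts (join G H) = Inr ` verts H"
    using assms by (auto simp: join_def)
  then show ?thesis
    by (simp add: proper_coloring_def) (simp add: join_def)
qed

lemma chromatic_number_join_empty:
  assumes "verts G = {}"
  shows "chromatic_number (join G H) = chromatic_number H"
proof -
  have "colorable (join G H) k \<longleftrightarrow> colorable H k" for k
  proof
    assume "colorable (join G H) k"
    then obtain c where "proper_coloring H (c \<circ> Inr)" "c ` verts (join G H) \<subseteq> {..<k}"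
      by (auto simp: colorable_def proper_coloring_join_empty[OF assms])
    then show "colorable H k"
      unfolding colorable_def by (intro exI[of _ "c \<circ> Inr"]) (auto simp: join_def)
  next
    assume "colorable H k"
    then obtain c where "proper_coloring H c" "c ` verts H \<subseteq> {..<k}"
      by (auto simp: colorable_def)
    then show "colorable (join G H) k"
      unfolding colorable_def proper_coloring_join_empty[OF assms]
      by (intro exI[of _ "case_sum (\<lambda>_. 0) c"]) (auto simp: join_def assms comp_def)
  qed
  then show ?thesis by (simp add: chromatic_number_def)
qed

lemma list_chromatic_number_join_empty:
  assumes "verts G = {}"
  shows "list_chromatic_number (join G H) = list_chromatic_number H"
proof -
  have V: "verts (join G H) = Inr ` verts H"
    using assms by (auto simp: join_def)
  have "choosable (join G H) k \<longleftrightarrow> choosable H k" for k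
  proof
    assume ch: "choosable (join G H) k"
    show "choosable H k"
      unfolding choosable_def
    proof (intro allI impI)
      fix L :: "_ \<Rightarrow> nat set"
      assume "\<forall>v\<in>verts H. finite (L v) \<and> card (L v) = k"
      then have "\<forall>v\<in>verts (join G H).
          finite (case_sum (\<lambda>_. {}) L v) \<and> card (case_sum (\<lambda>_. {}) L v) = k"
        by (simp add: V)
      then obtain c where "proper_coloring (join G H) c" "\<forall>v\<in>verts H. c (Inr v) \<in> L v"
        using ch[unfolded choosable_def, THEN spec, of "case_sum (\<lambda>_. {}) L"]
        by (auto simp: V)
      then show "\<exists>c. proper_coloring H c \<and> (\<forall>v\<in>verts H. c v \<in> L v)"
        by (intro exI[of _ "c \<circ> Inr"]) (auto simp: proper_coloring_join_empty[OF assms])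
    qed
  next
    assume ch: "choosable H k"
    show "choosable (join G H) k"
      unfolding choosable_def
    proof (intro allI impI)
      fix L :: "_ \<Rightarrow> nat set"
      assume "\<forall>v\<in>verts (join G H). finite (L v) \<and> card (L v) = k"
      then obtain c where "proper_coloring H c" "\<forall>v\<in>verts H. c v \<in> L (Inr v)"
        using ch[unfolded choosable_def, rule_format, of "L \<circ> Inr"] by (auto simp: V)
      then show "\<exists>c. proper_coloring (join G H) c \<and> (\<forall>v\<in>verts (join G H). c v \<in> L v)"
        by (intro exI[of _ "case_sum (\<lambda>_. 0) c"])
           (auto simp: proper_coloring_join_empty[OF assms] V comp_def)
    qed
  qed
  then show ?thesis by (simp add: list_chromatic_number_def)
qed

end

theory Submission
  imports Defs "HOL-Library.FuncSet" "HOL-Library.Disjoint_Sets"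
begin

text \<open>
  Give $K_n \vee K_{a,b}$ lists of size $n + a$. A colouring of the $n$ clique vertices and the $a$
  vertices of the first side extends to the second side unless the set of its colours is the list
  of some vertex there. If two lists on the first side meet, repeating a common colour uses fewer
  than $n + a$ colours, so these lists may be taken disjoint. For $n = 0$ distinct colourings then
  use distinct colour sets, and $a^a$ lists are needed to block them all. For $n = 1$ and
  $k = a + 1$ there are at least $k (k - 1) k^{a - 1}$ colourings and a colour set arises from at
  most two of them, so $\binom{k}{2} k^{a - 1}$ lists are needed; this many suffice when the
  clique vertex has the same list as one vertex of the first side.
\<close>

section \<open>Chromatic number of the join\<close>

abbreviation join_Kn_Kab :: "nat \<Rightarrow> nat \<Rightarrow> nat \<Rightarrow> (nat + nat + nat) graph" where
  "join_Kn_Kab n a b \<equiv> join (complete_graph n) (complete_bipartite a b)"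

lemma verts_join_Kn_Kab: "verts (join_Kn_Kab n a b) = {..<n} <+> ({..<a} <+> {..<b})"
  by (simp add: join_def complete_graph_def complete_bipartite_def)

lemma ball_Plus: "(\<forall>x\<in>A <+> B. P x) \<longleftrightarrow> (\<forall>x\<in>A. P (Inl x)) \<and> (\<forall>y\<in>B. P (Inr y))"
  by (auto simp: Plus_def)

lemma proper_coloring_join_Kn_Kab:
  "proper_coloring (join_Kn_Kab n a b) f \<longleftrightarrow>
     inj_on (\<lambda>i. f (Inl i)) {..<n} \<and>
     (\<forall>i<n. \<forall>j<a. f (Inl i) \<noteq> f (Inr (Inl j))) \<and>
     (\<forall>i<n. \<forall>j<b. f (Inl i) \<noteq> f (Inr (Inr j))) \<and>
     (\<forall>i<a. \<forall>j<b. f (Inr (Inl i)) \<noteq> f (Inr (Inr j)))"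
  unfolding proper_coloring_def verts_join_Kn_Kab ball_Plus
  by (auto simp: join_def complete_graph_def complete_bipartite_def inj_on_def; metis)

lemma colorable_join_Kn_Kab: "colorable (join_Kn_Kab n a b) (n + 2)"
  unfolding colorable_def proper_coloring_join_Kn_Kab
  by (intro exI[of _ "case_sum (\<lambda>i. i) (case_sum (\<lambda>_. n) (\<lambda>_. n + 1))"])
     (auto simp: verts_join_Kn_Kab inj_on_def)

text \<open>The clique and one vertex from each side form a clique on \<open>n + 2\<close>
  vertices.\<close>

lemma colorable_join_Kn_Kab_ge:
  assumes "colorable (join_Kn_Kab n a b) k" "a \<ge> 1" "b \<ge> 1"
  shows "n + 2 \<le> k"
proof -
  obtain f where f: "proper_coloring (join_Kn_Kab n a b) f"
    and sub: "f ` verts (join_Kn_Kab n a b) \<subseteq> {..<k}"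
    using assms(1) by (auto simp: colorable_def)
  let ?A = "(\<lambda>i. f (Inl i)) ` {..<n}"
  let ?S = "insert (f (Inr (Inl 0))) (insert (f (Inr (Inr 0))) ?A)"
  have "f (Inr (Inl 0)) \<notin> insert (f (Inr (Inr 0))) ?A" "f (Inr (Inr 0)) \<notin> ?A" "card ?A = n"
    using f assms(2,3) unfolding proper_coloring_join_Kn_Kab
    by (fastforce simp: card_image)+
  then have "card ?S = n + 2" by simp
  moreover have "?S \<subseteq> {..<k}"
  proof -
    have "f v < k" if "v \<in> verts (join_Kn_Kab n a b)" for v
      using sub that by blast
    note less = this[unfolded verts_join_Kn_Kab]
    show ?thesis using assms(2,3) by (auto intro!: less)
  qed
  ultimately show ?thesis
    using card_mono[of "{..<k}" ?S] by simp
qed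

lemma chromatic_number_join_Kn_Kab:
  assumes "a \<ge> 1" "b \<ge> 1"
  shows "chromatic_number (join_Kn_Kab n a b) = n + 2"
  unfolding chromatic_number_def
  using colorable_join_Kn_Kab colorable_join_Kn_Kab_ge assms by (intro Least_equality)

section \<open>Choosability as a threshold\<close>

lemma choosable_mono:
  assumes "choosable G k" "k \<le> l"
  shows "choosable G l"
  unfolding choosable_def
proof (intro allI impI)
  fix L :: "_ \<Rightarrow> nat set"
  assume L: "\<forall>v\<in>verts G. finite (L v) \<and> card (L v) = l"
  have "\<forall>v\<in>verts G. \<exists>M. M \<subseteq> L v \<and> finite M \<and> card M = k"
  proof
    fix v assume "v \<in> verts G"
    then have "k \<le> card (L v)" using L assms(2) by simp
    then show "\<exists>M. M \<subseteq> L v \<and> finite M \<and> card M = k"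
      by (rule obtain_subset_with_card_n) blast
  qed
  then obtain M where M: "\<forall>v\<in>verts G. M v \<subseteq> L v \<and> finite (M v) \<and> card (M v) = k"
    by metis
  with assms(1) obtain c where "proper_coloring G c" "\<forall>v\<in>verts G. c v \<in> M v"
    unfolding choosable_def by blast
  with M show "\<exists>c. proper_coloring G c \<and> (\<forall>v\<in>verts G. c v \<in> L v)"
    by blast
qed

text \<open>The witness \<open>m\<close> ensures that \<open>LEAST\<close> is attained; upward
  closure does the rest.\<close>

lemma list_chromatic_number_le_iff:
  assumes "choosable G m"
  shows "list_chromatic_number G \<le> k \<longleftrightarrow> choosable G k"
  unfolding list_chromatic_number_def
  using assms by (metis LeastI Least_le choosable_mono)

section \<open>Reduction to the clique and the first side\<close>

text \<open>The second side is left out: its vertices are pairwise nonadjacent, so only the colours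
  used elsewhere constrain them. For the same reason \<open>c\<close> may repeat colours.\<close>

definition partial_list_coloring ::
    "nat \<Rightarrow> nat \<Rightarrow> (nat \<Rightarrow> nat set) \<Rightarrow> (nat \<Rightarrow> nat set) \<Rightarrow> (nat \<Rightarrow> nat) \<Rightarrow> (nat \<Rightarrow> nat) \<Rightarrow> bool" where
  "partial_list_coloring n a D A d c \<longleftrightarrow>
     inj_on d {..<n} \<and> (\<forall>i<n. d i \<in> D i) \<and> (\<forall>i<a. c i \<in> A i) \<and> d ` {..<n} \<inter> c ` {..<a} = {}"

abbreviation k_lists :: "nat \<Rightarrow> nat \<Rightarrow> (nat \<Rightarrow> nat set) \<Rightarrow> bool" where
  "k_lists k m L \<equiv> \<forall>i<m. finite (L i) \<and> card (L i) = k"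

text \<open>A second-side vertex is adjacent to all other vertices except those of its own side, so
  it can be coloured on its own exactly when its list is not contained in the set of used
  colours.\<close>

lemma choosable_join_Kn_Kab:
  "choosable (join_Kn_Kab n a b) k \<longleftrightarrow>
     (\<forall>D A B. k_lists k n D \<longrightarrow> k_lists k a A \<longrightarrow> k_lists k b B \<longrightarrow>
       (\<exists>d c. partial_list_coloring n a D A d c \<and>
              (\<forall>j<b. \<not> B j \<subseteq> d ` {..<n} \<union> c ` {..<a})))"
  (is "?L \<longleftrightarrow> ?R")
proof
  assume ch: ?L
  show ?R
  proof (intro allI impI)
    fix D A B :: "nat \<Rightarrow> nat set"
    assume "k_lists k n D" "k_lists k a A" "k_lists k b B"
    then have "\<forall>v\<in>verts (join_Kn_Kab n a b).
        finite (case_sum D (case_sum A B) v) \<and> card (case_sum D (case_sum A B) v) = k"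
      unfolding verts_join_Kn_Kab ball_Plus by simp
    then obtain f where f: "proper_coloring (join_Kn_Kab n a b) f"
      and fL: "\<forall>v\<in>verts (join_Kn_Kab n a b). f v \<in> case_sum D (case_sum A B) v"
      using ch unfolding choosable_def by blast
    show "\<exists>d c. partial_list_coloring n a D A d c \<and>
              (\<forall>j<b. \<not> B j \<subseteq> d ` {..<n} \<union> c ` {..<a})"
    proof (intro exI conjI allI impI)
      show "partial_list_coloring n a D A (\<lambda>i. f (Inl i)) (\<lambda>i. f (Inr (Inl i)))"
        using f fL unfolding proper_coloring_join_Kn_Kab verts_join_Kn_Kab ball_Plus
          partial_list_coloring_def by auto
      fix j assume "j < b"
      then have "f (Inr (Inr j)) \<in> B j"
        "f (Inr (Inr j)) \<notin> (\<lambda>i. f (Inl i)) ` {..<n} \<union> (\<lambda>i. f (Inr (Inl i))) ` {..<a}"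
        using f fL unfolding proper_coloring_join_Kn_Kab verts_join_Kn_Kab ball_Plus
        by fastforce+
      then show "\<not> B j \<subseteq> (\<lambda>i. f (Inl i)) ` {..<n} \<union> (\<lambda>i. f (Inr (Inl i))) ` {..<a}"
        by blast
    qed
  qed
next
  assume R: ?R
  show ?L
    unfolding choosable_def
  proof (intro allI impI)
    fix L :: "_ \<Rightarrow> nat set"
    assume "\<forall>v\<in>verts (join_Kn_Kab n a b). finite (L v) \<and> card (L v) = k"
    then obtain d c where dc: "partial_list_coloring n a (\<lambda>i. L (Inl i)) (\<lambda>i. L (Inr (Inl i))) d c"
      and B: "\<forall>j<b. \<not> L (Inr (Inr j)) \<subseteq> d ` {..<n} \<union> c ` {..<a}"
      using R[rule_format, of "\<lambda>i. L (Inl i)" "\<lambda>i. L (Inr (Inl i))" "\<lambda>i. L (Inr (Inr i))"]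
      unfolding verts_join_Kn_Kab ball_Plus by auto
    from B have "\<forall>j<b. \<exists>x. x \<in> L (Inr (Inr j)) \<and> x \<notin> d ` {..<n} \<union> c ` {..<a}"
      by blast
    then obtain e where e: "\<forall>j<b. e j \<in> L (Inr (Inr j)) \<and> e j \<notin> d ` {..<n} \<union> c ` {..<a}"
      by metis
    show "\<exists>f. proper_coloring (join_Kn_Kab n a b) f \<and>
        (\<forall>v\<in>verts (join_Kn_Kab n a b). f v \<in> L v)"
    proof (intro exI[of _ "case_sum d (case_sum c e)"] conjI)
      have "d i \<noteq> c j" if "i < n" "j < a" for i j
        using dc that by (auto simp: partial_list_coloring_def)
      moreover have "d i \<noteq> e j" if "i < n" "j < b" for i j
        using e that by (metis UnI1 imageI lessThan_iff)
      moreover have "c i \<noteq> e j" if "i < a" "j < b" for i j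
        using e that by (metis UnI2 imageI lessThan_iff)
      ultimately show "proper_coloring (join_Kn_Kab n a b) (case_sum d (case_sum c e))"
        using dc by (simp add: proper_coloring_join_Kn_Kab partial_list_coloring_def)
    qed (use dc e in \<open>simp add: verts_join_Kn_Kab ball_Plus partial_list_coloring_def\<close>)
  qed
qed

section \<open>Greedy colouring of the clique\<close>

lemma greedy_distinct_representatives:
  assumes "finite I" "finite U" "\<forall>i\<in>I. finite (D i) \<and> card U + card I \<le> card (D i)"
  shows "\<exists>d. inj_on d I \<and> (\<forall>i\<in>I. d i \<in> D i - U)"
  using assms
proof (induction I)
  case empty
  then show ?case by simp
next
  case (insert x I)
  then obtain d where d: "inj_on d I" "\<forall>i\<in>I. d i \<in> D i - U"
    by fastforce
  have "card (U \<union> d ` I) < card (D x)"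
    using insert.prems insert.hyps card_Un_le[of U "d ` I"] card_image_le[OF insert.hyps(1), of d]
    by fastforce
  then obtain y where y: "y \<in> D x" "y \<notin> U \<union> d ` I"
    by (metis card_mono finite_UnI finite_imageI insert.hyps(1) insert.prems(1) linorder_not_less
        subsetI)
  show ?case
    using d y insert.hyps by (intro exI[of _ "d(x := y)"]) (auto simp: inj_on_def)
qed

text \<open>The vertices outside \<open>I\<close> are coloured greedily, avoiding the colours of
  \<open>c\<close> and those fixed on \<open>I\<close>. These forbidden colours and the remaining
  vertices together number at most \<open>k\<close>.\<close>

lemma partial_list_coloring_extend:
  assumes "k_lists k n D" "\<forall>i<a. c i \<in> A i" "I \<subseteq> {..<n}" "inj_on d I" "\<forall>i\<in>I. d i \<in> D i"
    "d ` I \<inter> c ` {..<a} = {}" "card (c ` {..<a}) + n \<le> k"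
  shows "\<exists>d'. partial_list_coloring n a D A d' c \<and> (\<forall>i\<in>I. d' i = d i)"
proof -
  let ?U = "c ` {..<a} \<union> d ` I"
  have fI: "finite I" using assms(3) finite_subset by blast
  have "card ?U + card ({..<n} - I) \<le> k"
    using card_Un_le[of "c ` {..<a}" "d ` I"] card_image_le[OF fI, of d]
      card_mono[OF _ assms(3)] card_Diff_subset[OF fI assms(3)] assms(7) by simp
  then obtain e where e: "inj_on e ({..<n} - I)" "\<forall>i\<in>{..<n} - I. e i \<in> D i - ?U"
    using greedy_distinct_representatives[of "{..<n} - I" ?U D] fI assms(1) by fastforce
  let ?d = "\<lambda>i. if i \<in> I then d i else e i"
  have "partial_list_coloring n a D A ?d c"
    unfolding partial_list_coloring_def
  proof (intro conjI)
    show "inj_on ?d {..<n}"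
      using assms(4) e unfolding inj_on_def
      by (smt (verit) DiffD2 DiffI UnCI image_eqI)
    show "\<forall>i<n. ?d i \<in> D i" using assms(5) e(2) by auto
    have "?d i \<notin> c ` {..<a}" if "i < n" for i
      using assms(6) e(2) that by (cases "i \<in> I") auto
    then show "?d ` {..<n} \<inter> c ` {..<a} = {}" by blast
  qed (use assms(2) in auto)
  then show ?thesis by (intro exI[of _ ?d]) auto
qed

text \<open>Fewer than \<open>k\<close> colours are used in all, so no list of size \<open>k\<close>
  fits inside the used set.\<close>

lemma partial_list_coloring_few_colors:
  assumes "k_lists k n D" "k_lists k b B" "\<forall>i<a. c i \<in> A i" "card (c ` {..<a}) + n < k"
  shows "\<exists>d. partial_list_coloring n a D A d c \<and> (\<forall>j<b. \<not> B j \<subseteq> d ` {..<n} \<union> c ` {..<a})"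
proof -
  obtain d where d: "partial_list_coloring n a D A d c"
    using partial_list_coloring_extend[of n D k a c A "{}"] assms(1,3,4) by auto
  have "card (d ` {..<n} \<union> c ` {..<a}) < k"
    using card_Un_le[of "d ` {..<n}" "c ` {..<a}"] card_image_le[of "{..<n}" d] assms(4) by simp
  then have "\<not> B j \<subseteq> d ` {..<n} \<union> c ` {..<a}" if "j < b" for j
    using that assms(2) card_mono[of "d ` {..<n} \<union> c ` {..<a}" "B j"] by fastforce
  with d show ?thesis by blast
qed

lemma card_image_not_inj_less:
  assumes "finite S" "\<not> inj_on f S"
  shows "card (f ` S) < card S"
  using assms card_image_le eq_card_imp_inj_on order_le_less by metis

text \<open>At most \<open>n + a\<close> colours are ever used. This supplies the choosable value
  that \<open>list_chromatic_number_le_iff\<close> asks for.\<close>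

lemma choosable_join_Kn_Kab_greedy: "choosable (join_Kn_Kab n a b) (n + a + 1)"
  unfolding choosable_join_Kn_Kab
proof (intro allI impI)
  fix D A B :: "nat \<Rightarrow> nat set"
  assume D: "k_lists (n + a + 1) n D" and A: "k_lists (n + a + 1) a A"
    and B: "k_lists (n + a + 1) b B"
  have "\<forall>i<a. \<exists>x. x \<in> A i"
    using A by (metis One_nat_def add_is_0 all_not_in_conv card.empty zero_neq_one)
  then obtain c where c: "\<forall>i<a. c i \<in> A i" by metis
  have "card (c ` {..<a}) + n < n + a + 1" using card_image_le[of "{..<a}" c] by simp
  from partial_list_coloring_few_colors[OF D B c this]
  show "\<exists>d c. partial_list_coloring n a D A d c \<and>
      (\<forall>j<b. \<not> B j \<subseteq> d ` {..<n} \<union> c ` {..<a})"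
    by blast
qed

section \<open>Choosability when the second side is small\<close>

text \<open>If two first-side lists meet, a common colour goes to both vertices and fewer than
  \<open>n + a\<close> colours are used. If they are disjoint, a list of size \<open>n + a\<close>
  inside the used set must equal it, so only equality has to be avoided.\<close>

lemma choosable_join_Kn_Kab_disjoint:
  assumes "\<And>D A B. k_lists (n + a) n D \<Longrightarrow> k_lists (n + a) a A \<Longrightarrow> k_lists (n + a) b B \<Longrightarrow>
      disjoint_family_on A {..<a} \<Longrightarrow>
      \<exists>d c. partial_list_coloring n a D A d c \<and> (\<forall>j<b. B j \<noteq> d ` {..<n} \<union> c ` {..<a})"
  shows "choosable (join_Kn_Kab n a b) (n + a)"
  unfolding choosable_join_Kn_Kab
proof (intro allI impI)
  fix D A B :: "nat \<Rightarrow> nat set"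
  assume D: "k_lists (n + a) n D" and A: "k_lists (n + a) a A" and B: "k_lists (n + a) b B"
  show "\<exists>d c. partial_list_coloring n a D A d c \<and>
      (\<forall>j<b. \<not> B j \<subseteq> d ` {..<n} \<union> c ` {..<a})"
  proof (cases "disjoint_family_on A {..<a}")
    case True
    then obtain d c where dc: "partial_list_coloring n a D A d c"
      and ne: "\<forall>j<b. B j \<noteq> d ` {..<n} \<union> c ` {..<a}"
      using assms[OF D A B True] by blast
    have "card (d ` {..<n} \<union> c ` {..<a}) \<le> n + a"
      using card_Un_le[of "d ` {..<n}" "c ` {..<a}"] card_image_le[of "{..<n}" d]
        card_image_le[of "{..<a}" c] by simp
    then have "\<forall>j<b. \<not> B j \<subseteq> d ` {..<n} \<union> c ` {..<a}"
      using ne B by (metis card_seteq finite_Un finite_imageI finite_lessThan)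
    with dc show ?thesis by blast
  next
    case False
    then obtain p q x where pq: "p < a" "q < a" "p \<noteq> q" "x \<in> A p" "x \<in> A q"
      by (auto simp: disjoint_family_on_def)
    have "\<forall>i<a. \<exists>y. y \<in> A i"
      using A pq(1) by (metis add_is_0 all_not_in_conv card.empty not_less_zero)
    then obtain c where c: "\<forall>i<a. c i \<in> A i" by metis
    let ?c = "c(p := x, q := x)"
    have "card (?c ` {..<a}) < card {..<a}"
      using pq by (intro card_image_not_inj_less) (auto simp: inj_on_def)
    then have "card (?c ` {..<a}) + n < n + a" by simp
    moreover have "\<forall>i<a. ?c i \<in> A i" using c pq by simp
    ultimately show ?thesis
      using partial_list_coloring_few_colors[OF D B, of a ?c A] by blast
  qed
qed

text \<open>Disjointness lets a colour reveal the index it was chosen for.\<close>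

lemma transversal_eqD:
  assumes "disjoint_family_on A I" "c \<in> PiE I A" "c' \<in> PiE I A"
    "i \<in> I" "c i \<in> c' ` I"
  shows "c i = c' i"
proof -
  obtain j where j: "j \<in> I" "c i = c' j" using assms(5) by blast
  then have "c i \<in> A i \<inter> A j" using assms(2-4) PiE_mem by (metis IntI)
  then have "i = j" using assms(1,4) j(1) by (auto simp: disjoint_family_on_def)
  with j show ?thesis by simp
qed

text \<open>Otherwise the colour sets of all \<open>a ^ a\<close> transversals would occur among the
  \<open>b\<close> lists, and disjointness makes these sets distinct.\<close>

lemma choosable_Kab:
  assumes "b < a ^ a"
  shows "choosable (join_Kn_Kab 0 a b) (0 + a)"
proof (rule choosable_join_Kn_Kab_disjoint, rule ccontr)
  fix D A B :: "nat \<Rightarrow> nat set"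
  assume A: "k_lists (0 + a) a A" and dj: "disjoint_family_on A {..<a}"
    and "\<not> (\<exists>d c. partial_list_coloring 0 a D A d c \<and>
        (\<forall>j<b. B j \<noteq> d ` {..<0} \<union> c ` {..<a}))"
  then have "(\<lambda>c. c ` {..<a}) ` PiE {..<a} A \<subseteq> B ` {..<b}"
    by (fastforce simp: partial_list_coloring_def)
  moreover have "inj_on (\<lambda>c. c ` {..<a}) (PiE {..<a} A)"
  proof (rule inj_onI)
    fix c c' assume c: "c \<in> PiE {..<a} A" "c' \<in> PiE {..<a} A" "c ` {..<a} = c' ` {..<a}"
    have "c i = c' i" if "i \<in> {..<a}" for i
      by (rule transversal_eqD[OF dj c(1,2) that]) (metis c(3) that imageI)
    then show "c = c'" by (rule PiE_ext[OF c(1,2)])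
  qed
  moreover have "card (PiE {..<a} A) = a ^ a"
    using A by (simp add: card_PiE)
  ultimately have "a ^ a \<le> b"
    by (metis card_image card_image_le card_lessThan card_mono finite_imageI finite_lessThan
        le_trans)
  with assms show False by simp
qed

text \<open>A colour set determines the clique colour and the transversal up to one exchange: if the
  clique colours differ, \<open>x\<close> is taken over by the vertex whose list contains it, and
  the colour displaced there becomes \<open>x'\<close>.\<close>

lemma color_set_fibre:
  assumes dj: "disjoint_family_on A {..<a}"
    and c: "c \<in> PiE {..<a} A" "x \<notin> c ` {..<a}"
    and c': "c' \<in> PiE {..<a} A" "x' \<notin> c' ` {..<a}"
    and eq: "insert x (c ` {..<a}) = insert x' (c' ` {..<a})"
  shows "x' = x \<and> c' = c \<or> (\<exists>i<a. x \<in> A i \<and> x' = c i \<and> c' = c(i := x))"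
proof (cases "x' = x")
  case True
  then have im: "c ` {..<a} = c' ` {..<a}" using c(2) c'(2) eq by (metis insert_ident)
  have "c i = c' i" if "i \<in> {..<a}" for i
    by (rule transversal_eqD[OF dj c(1) c'(1) that]) (metis im that imageI)
  then have "c = c'" by (rule PiE_ext[OF c(1) c'(1)])
  then show ?thesis using True by simp
next
  case False
  then have "x \<in> c' ` {..<a}" using eq by (metis insertE insertI1)
  then obtain i where i: "i < a" "x = c' i" by blast
  \<comment> \<open>A colour of \<open>c\<close> other than \<open>x'\<close> must come from
    \<open>c'\<close>, hence from the same vertex.\<close>
  have other: "c j = c' j" if "j < a" "c j \<noteq> x'" for j
  proof (rule transversal_eqD[OF dj c(1) c'(1)])
    show "c j \<in> c' ` {..<a}" using eq that by (metis imageI insertE insertI2 lessThan_iff)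
  qed (use that in simp)
  have x': "x' = c i" using other[OF i(1)] i c(2) by (metis imageI lessThan_iff)
  have "c' j = (c(i := x)) j" for j
  proof (cases "j < a")
    case True
    then show ?thesis
    proof (cases "j = i")
      case False
      then have "c j \<noteq> c i"
        using dj c(1) True i(1) by (fastforce simp: disjoint_family_on_def)
      then show ?thesis using other[OF True] x' False by simp
    qed (use i in simp)
  next
    case False
    then show ?thesis using c(1) c'(1) i(1) by (auto simp: PiE_def extensional_def)
  qed
  then have "c' = c(i := x)" by (rule ext)
  moreover have "x \<in> A i" using PiE_mem[OF c'(1), of i] i by simp
  ultimately show ?thesis using i(1) x' by blast
qed

text \<open>By disjointness at most one list contains \<open>x\<close>; it loses one colour, and the
  other lists stay intact.\<close>

lemma card_PiE_avoiding:
  assumes A: "k_lists k a A" and dj: "disjoint_family_on A {..<a}" and "a \<ge> 1"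
  shows "(k - 1) * k ^ (a - 1) \<le> card {c \<in> PiE {..<a} A. x \<notin> c ` {..<a}}"
proof -
  \<comment> \<open>If no list contains \<open>x\<close>, index 0 stands in, and removing
    \<open>x\<close> there changes nothing.\<close>
  obtain p where p: "p < a" "\<forall>i<a. x \<in> A i \<longrightarrow> i = p"
  proof (cases "\<exists>i<a. x \<in> A i")
    case True
    then show ?thesis using that dj by (fastforce simp: disjoint_family_on_def)
  qed (use that[of 0] assms(3) in auto)
  let ?A = "A(p := A p - {x})"
  have "card (PiE {..<a} ?A) = (\<Prod>i<a. card (?A i))" by (simp add: card_PiE)
  also have "\<dots> = card (A p - {x}) * (\<Prod>i\<in>{..<a} - {p}. card (?A i))"
    using p(1) by (subst prod.remove[of _ p]) auto
  also have "(\<Prod>i\<in>{..<a} - {p}. card (?A i)) = k ^ (a - 1)"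
    using A p(1) by (simp add: card_Diff_subset)
  finally have card: "card (PiE {..<a} ?A) = card (A p - {x}) * k ^ (a - 1)" .
  have "k - 1 \<le> card (A p - {x})"
    using A p(1) by (metis card_Diff_singleton_if diff_le_self order_refl)
  then have "(k - 1) * k ^ (a - 1) \<le> card (PiE {..<a} ?A)"
    unfolding card by (rule mult_le_mono1)
  also have "\<dots> \<le> card {c \<in> PiE {..<a} A. x \<notin> c ` {..<a}}"
  proof (rule card_mono)
    show "PiE {..<a} ?A \<subseteq> {c \<in> PiE {..<a} A. x \<notin> c ` {..<a}}"
    proof
      fix c assume c: "c \<in> PiE {..<a} ?A"
      then have "c i \<in> A i \<and> c i \<noteq> x" if "i < a" for i
        using PiE_mem[OF c, of i] that p(2) by (auto split: if_splits)
      with c show "c \<in> {c \<in> PiE {..<a} A. x \<notin> c ` {..<a}}"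
        by (auto simp: PiE_def Pi_def)
    qed
    show "finite {c \<in> PiE {..<a} A. x \<notin> c ` {..<a}}"
      using finite_PiE[of "{..<a}" A] A by simp
  qed
  finally show ?thesis .
qed

lemma choose_two_mult: "2 * (k choose 2) = k * (k - 1)"
proof -
  have "even (k * (k - 1))" by (cases k) auto
  then show ?thesis by (simp add: choose_two)
qed

text \<open>Double counting: \<open>V\<close> holds the pairs of a clique colour and a transversal
  avoiding it, and \<open>S\<close> gives their colour sets. If all were blocked, \<open>S\<close>
  would map \<open>V\<close> into at most \<open>b\<close> lists, with at most two pairs over
  each.\<close>

lemma choosable_K1_Kab:
  assumes "a \<ge> 1" "b < ((a + 1) choose 2) * (a + 1) ^ (a - 1)"
  shows "choosable (join_Kn_Kab 1 a b) (1 + a)"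
proof (rule choosable_join_Kn_Kab_disjoint, rule ccontr)
  fix D A B :: "nat \<Rightarrow> nat set"
  assume D: "k_lists (1 + a) 1 D" and A: "k_lists (1 + a) a A"
    and dj: "disjoint_family_on A {..<a}"
    and no: "\<not> (\<exists>d c. partial_list_coloring 1 a D A d c \<and>
        (\<forall>j<b. B j \<noteq> d ` {..<1} \<union> c ` {..<a}))"
  define V where "V = (SIGMA x:D 0. {c \<in> PiE {..<a} A. x \<notin> c ` {..<a}})"
  define S where "S = (\<lambda>(x :: nat, c). insert x (c ` {..<a}))"
  have SV: "S z \<in> B ` {..<b}" if z: "z \<in> V" for z
  proof -
    obtain x c where xc: "z = (x, c)" "x \<in> D 0" "c \<in> PiE {..<a} A" "x \<notin> c ` {..<a}"
      using z by (auto simp: V_def)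
    then have "partial_list_coloring 1 a D A (\<lambda>_. x) c"
      by (auto simp: partial_list_coloring_def inj_on_def)
    moreover have "(\<lambda>_. x) ` {..<1::nat} = {x}" by auto
    ultimately show ?thesis using no xc(1) by (fastforce simp: S_def)
  qed
  have fibre: "card {z \<in> V. S z = T} \<le> 2" for T
  proof (cases "\<exists>z\<in>V. S z = T")
    case True
    then obtain x c where xc: "(x, c) \<in> V" "S (x, c) = T" by auto
    \<comment> \<open>At most one list contains \<open>x\<close>, so the exchange is unique. If none
      does, \<open>THE\<close> is arbitrary and the second pair below merely enlarges the bounding
      set.\<close>
    define i where "i = (THE i. i < a \<and> x \<in> A i)"
    have i: "i = j" if "j < a" "x \<in> A j" for j
      unfolding i_def using that dj
      by (intro the_equality) (fastforce simp: disjoint_family_on_def)+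
    have "{z \<in> V. S z = T} \<subseteq> {(x, c), (c i, c(i := x))}"
    proof
      fix z assume "z \<in> {z \<in> V. S z = T}"
      then obtain x' c' where z: "z = (x', c')" "(x', c') \<in> V" "S (x', c') = T"
        by (cases z) auto
      have "x' = x \<and> c' = c \<or> (\<exists>j<a. x \<in> A j \<and> x' = c j \<and> c' = c(j := x))"
        using xc z by (intro color_set_fibre[OF dj]) (simp_all add: V_def S_def)
      then show "z \<in> {(x, c), (c i, c(i := x))}"
        using z(1) i by blast
    qed
    then have "card {z \<in> V. S z = T} \<le> card {(x, c), (c i, c(i := x))}"
      by (intro card_mono) auto
    also have "\<dots> \<le> 2" by (simp add: card_insert_if)
    finally show ?thesis .
  next
    case False
    then have "{z \<in> V. S z = T} = {}" by blast
    then show ?thesis by (metis card.empty zero_le)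
  qed
  have "(a + 1) * (a * (a + 1) ^ (a - 1)) = (\<Sum>x\<in>D 0. a * (a + 1) ^ (a - 1))"
    using D by simp
  also have "\<dots> \<le> (\<Sum>x\<in>D 0. card {c \<in> PiE {..<a} A. x \<notin> c ` {..<a}})"
    using card_PiE_avoiding[OF A dj assms(1)] by (intro sum_mono) simp
  also have "\<dots> = card V"
    unfolding V_def using D A finite_PiE[of "{..<a}" A] by (subst card_SigmaI) auto
  also have "\<dots> \<le> (\<Sum>T\<in>B ` {..<b}. card {z \<in> V. S z = T})"
  proof -
    have "(\<Union>T\<in>B ` {..<b}. {z \<in> V. S z = T}) = {z \<in> V. S z \<in> B ` {..<b}}" by auto
    also have "\<dots> = V" by (intro equalityI subsetI CollectI conjI SV) simp_all
    finally show ?thesis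
      using card_UN_le[where I = "B ` {..<b}" and A = "\<lambda>T. {z \<in> V. S z = T}"] by simp
  qed
  also have "\<dots> \<le> card (B ` {..<b}) * 2"
    using sum_bounded_above[of "B ` {..<b}" "\<lambda>T. card {z \<in> V. S z = T}" 2] fibre by simp
  also have "\<dots> \<le> 2 * b" using card_image_le[of "{..<b}" B] by simp
  finally have "(a + 1) * a * (a + 1) ^ (a - 1) \<le> 2 * b" by (simp only: mult.assoc)
  moreover have "(a + 1) * a = 2 * ((a + 1) choose 2)"
    using choose_two_mult[of "a + 1"] by simp
  ultimately show False using assms(2) by (simp add: mult.assoc)
qed

section \<open>List assignments that block every colouring\<close>

text \<open>If \<open>F\<close> captures every possible colour set, its members used as second-side
  lists block all colourings.\<close>

lemma not_choosable_join_Kn_Kab: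
  assumes F: "finite F" "F \<noteq> {}" "card F \<le> b" "\<forall>S\<in>F. finite S \<and> card S = k"
    and D: "k_lists k n D" and A: "k_lists k a A"
    and cov: "\<And>d c. partial_list_coloring n a D A d c \<Longrightarrow> d ` {..<n} \<union> c ` {..<a} \<in> F"
  shows "\<not> choosable (join_Kn_Kab n a b) k"
proof
  assume ch: "choosable (join_Kn_Kab n a b) k"
  obtain g where g: "g ` {..<card F} = F"
    using ex_bij_betw_nat_finite[OF F(1)] by (auto simp: bij_betw_def atLeast0LessThan)
  obtain S0 where S0: "S0 \<in> F" using F(2) by blast
  \<comment> \<open>Vertices beyond the first \<open>card F\<close> repeat one member of
    \<open>F\<close>.\<close>
  let ?B = "\<lambda>j. if j < card F then g j else S0"
  have BF: "?B j \<in> F" for j using g S0 by auto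
  then have B: "k_lists k b ?B" using F(4) by blast
  obtain d c where dc: "partial_list_coloring n a D A d c"
    and no: "\<forall>j<b. \<not> ?B j \<subseteq> d ` {..<n} \<union> c ` {..<a}"
    using ch[unfolded choosable_join_Kn_Kab, THEN spec, THEN spec, THEN spec, THEN mp, THEN mp,
        THEN mp, OF D A B] by blast
  obtain j where "j < card F" "g j = d ` {..<n} \<union> c ` {..<a}"
    using cov[OF dc] g by (metis imageE lessThan_iff)
  then show False using no[rule_format, of j] F(3) by simp
qed

text \<open>Consecutive intervals serve as pairwise disjoint lists of size \<open>k\<close>;
  division by \<open>k\<close> recovers the index.\<close>

definition block :: "nat \<Rightarrow> nat \<Rightarrow> nat set" where
  "block k i = {i * k..<i * k + k}"

lemma block_div: "x \<in> block k i \<Longrightarrow> x div k = i"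
  by (auto simp: block_def mult.commute intro!: div_nat_eqI)

lemma card_image_block:
  assumes "\<forall>i\<in>I. c i \<in> block k i"
  shows "card (c ` I) = card I"
  using assms by (intro card_image inj_onI) (metis block_div)

text \<open>With disjoint blocks on the first side, the colour sets are the images of transversals:
  at most \<open>a ^ a\<close> sets, each of size \<open>a\<close>.\<close>

lemma not_choosable_Kab:
  assumes "a \<ge> 1" "a ^ a \<le> b"
  shows "\<not> choosable (join_Kn_Kab 0 a b) (0 + a)"
proof (rule not_choosable_join_Kn_Kab[where D = "block a" and A = "block a"])
  let ?P = "PiE {..<a} (block a)"
  let ?F = "(\<lambda>c. c ` {..<a}) ` ?P"
  have fin: "finite ?P" by (simp add: finite_PiE block_def)
  then show "finite ?F" by simp
  show "?F \<noteq> {}" using assms(1) by (simp add: PiE_eq_empty_iff block_def)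
  have "card ?P = a ^ a" by (simp add: card_PiE block_def)
  then show "card ?F \<le> b" using card_image_le[OF fin, of "\<lambda>c. c ` {..<a}"] assms(2) by linarith
  show "\<forall>S\<in>?F. finite S \<and> card S = 0 + a"
    using card_image_block[of "{..<a}"] by (auto simp: PiE_iff)
  fix d c assume "partial_list_coloring 0 a (block a) (block a) d c"
  then have "restrict c {..<a} \<in> ?P"
    by (auto simp: partial_list_coloring_def)
  moreover have "d ` {..<0} \<union> c ` {..<a} = restrict c {..<a} ` {..<a}" by simp
  ultimately show "d ` {..<0} \<union> c ` {..<a} \<in> ?F" by blast
qed (simp_all add: block_def)

text \<open>The clique vertex and vertex 0 of the first side share block 0. Being adjacent, they use
  two distinct colours, of which the colour set records only the unordered pair; this gives the
  binomial coefficient.\<close>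

lemma not_choosable_K1_Kab:
  assumes "a \<ge> 1" "((a + 1) choose 2) * (a + 1) ^ (a - 1) \<le> b"
  shows "\<not> choosable (join_Kn_Kab 1 a b) (1 + a)"
proof (rule not_choosable_join_Kn_Kab[where D = "block (1 + a)" and A = "block (1 + a)"])
  let ?L = "block (1 + a)"
  let ?Q = "{Q. Q \<subseteq> ?L 0 \<and> card Q = 2}"
  let ?P = "PiE {1..<a} ?L"
  let ?f = "\<lambda>(Q, c). Q \<union> c ` {1..<a}"
  let ?F = "?f ` (?Q \<times> ?P)"
  have finL: "finite (?L i)" "card (?L i) = a + 1" for i by (simp_all add: block_def)
  then have finQ: "finite ?Q" by simp
  have cardQ: "card ?Q = (a + 1) choose 2" using n_subsets[OF finL(1), of 0 2] finL by simp
  have finP: "finite ?P" using finL by (simp add: finite_PiE)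
  have cardP: "card ?P = (a + 1) ^ (a - 1)" by (simp add: card_PiE block_def)
  show "finite ?F" using finQ finP by simp
  have "card (?Q \<times> ?P) = ((a + 1) choose 2) * (a + 1) ^ (a - 1)"
    using cardQ cardP by (simp add: card_cartesian_product)
  moreover have "((a + 1) choose 2) * (a + 1) ^ (a - 1) > 0"
    using assms(1) by (simp add: zero_less_binomial_iff)
  ultimately have nonempty: "?Q \<times> ?P \<noteq> {}" and le: "card (?Q \<times> ?P) \<le> b"
    using assms(2) by (metis card.empty less_numeral_extra(3), simp only:)
  show "?F \<noteq> {}" using nonempty by (simp only: image_is_empty not_False_eq_True)
  show "card ?F \<le> b"
    using card_image_le[OF finite_cartesian_product[OF finQ finP]] le by (rule le_trans)
  show "\<forall>S\<in>?F. finite S \<and> card S = 1 + a"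
  proof clarify
    fix Q c assume Q: "Q \<subseteq> ?L 0" "card Q = 2" and c: "c \<in> ?P"
    have "card (c ` {1..<a}) = a - 1"
      using card_image_block[of "{1..<a}" c] c by (auto simp: PiE_iff)
    moreover have "Q \<inter> c ` {1..<a} = {}"
    proof -
      have "c i \<notin> ?L 0" if "i \<in> {1..<a}" for i
        using block_div[of "c i" "1 + a"] PiE_mem[OF c that] that
        by (metis atLeastLessThan_iff not_one_le_zero)
      then show ?thesis using Q(1) by blast
    qed
    moreover have "finite Q" using Q(1) finL finite_subset by blast
    ultimately show "finite (Q \<union> c ` {1..<a}) \<and> card (Q \<union> c ` {1..<a}) = 1 + a"
      using Q(2) assms(1) by (simp add: card_Un_disjoint)
  qed
  fix d c assume dc: "partial_list_coloring 1 a ?L ?L d c"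
  have sets: "{..<a} = insert 0 {1..<a}" "{..<1::nat} = {0}" using assms(1) by auto
  have "d 0 \<noteq> c 0" using dc unfolding partial_list_coloring_def sets by blast
  then have "{d 0, c 0} \<in> ?Q"
    using dc assms(1) by (auto simp: partial_list_coloring_def)
  moreover have "restrict c {1..<a} \<in> ?P"
    using dc by (auto simp: partial_list_coloring_def)
  moreover have "d ` {..<1} \<union> c ` {..<a} = ?f ({d 0, c 0}, restrict c {1..<a})"
    unfolding sets by auto
  ultimately show "d ` {..<1} \<union> c ` {..<a} \<in> ?F" by blast
qed (simp_all add: block_def)

section \<open>Choosability for a large clique\<close>

text \<open>
  Since \<^const>\<open>tau\<close> is a \<open>LEAST\<close>, its value says nothing unless some $n$ satisfies the bound.
  A list is blocked as long as it contains all colours used so far. An uncoloured clique vertex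
  with a different list then has a colour outside it, and this colour is automatically new.
\<close>

lemma choosable_join_Kn_Kab_large:
  assumes "a \<ge> 2"
  shows "choosable (join_Kn_Kab (2 * b) a b) (2 * b + a)"
proof (rule choosable_join_Kn_Kab_disjoint)
  fix D A B :: "nat \<Rightarrow> nat set"
  let ?n = "2 * b"
  let ?k = "?n + a"
  assume D: "k_lists ?k ?n D" and A: "k_lists ?k a A" and B: "k_lists ?k b B"
    and dj: "disjoint_family_on A {..<a}"
  define cnt where "cnt X = card {i \<in> {..<?n}. D i \<noteq> X}" for X
  \<comment> \<open>Every clique list differs from at least one of two distinct sets, so two sets
    cannot both have \<open>cnt\<close> below \<open>b\<close>. \<open>M\<close> is the possible
    exception, with the empty set as default.\<close>
  obtain M where M: "finite M" "card M \<le> ?k" "\<And>X. X \<noteq> M \<Longrightarrow> b \<le> cnt X"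
  proof (cases "\<exists>i<?n. cnt (D i) < b")
    case True
    then obtain i where i: "i < ?n" "cnt (D i) < b" by blast
    have "b \<le> cnt X" if "X \<noteq> D i" for X
    proof -
      have "{..<?n} \<subseteq> {l \<in> {..<?n}. D l \<noteq> X} \<union> {l \<in> {..<?n}. D l \<noteq> D i}"
        using that by auto
      then have "?n \<le> card ({l \<in> {..<?n}. D l \<noteq> X} \<union> {l \<in> {..<?n}. D l \<noteq> D i})"
        using card_mono[of "{l \<in> {..<?n}. D l \<noteq> X} \<union> {l \<in> {..<?n}. D l \<noteq> D i}" "{..<?n}"]
        by simp
      also have "\<dots> \<le> cnt X + cnt (D i)" unfolding cnt_def by (rule card_Un_le)
      finally show ?thesis using i(2) by simp
    qed
    then show ?thesis using that[of "D i"] D i(1) by simp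
  next
    case False
    have "b \<le> cnt X" for X
    proof (cases "\<exists>i<?n. D i = X")
      case False
      then have "{i \<in> {..<?n}. D i \<noteq> X} = {..<?n}" by auto
      then show ?thesis by (simp add: cnt_def)
    qed (use False in force)
    then show ?thesis using that[of "{}"] by simp
  qed
  obtain p where p: "p < a" "\<not> A p \<subseteq> M"
  proof -
    \<comment> \<open>Two disjoint lists hold \<open>2 * ?k\<close> colours, too many for
      \<open>M\<close>.\<close>
    have "\<not> (A 0 \<subseteq> M \<and> A 1 \<subseteq> M)"
    proof
      assume sub: "A 0 \<subseteq> M \<and> A 1 \<subseteq> M"
      have "A 0 \<inter> A 1 = {}" using dj assms by (auto simp: disjoint_family_on_def)
      then have "card (A 0 \<union> A 1) = ?k + ?k" using A assms by (simp add: card_Un_disjoint)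
      moreover have "card (A 0 \<union> A 1) \<le> card M" using sub M(1) by (intro card_mono) auto
      ultimately show False using M(2) assms by simp
    qed
    then show ?thesis using that[of 0] that[of 1] assms by auto
  qed
  then obtain y where y: "y \<in> A p" "y \<notin> M" by blast
  have "\<forall>i<a. \<exists>x. x \<in> A i"
    using A assms by (metis add_is_0 all_not_in_conv card.empty not_numeral_le_zero)
  then obtain c0 where c0: "\<forall>i<a. c0 i \<in> A i" by metis
  \<comment> \<open>The colour \<open>y\<close> keeps \<open>M\<close> from ever being blocked, so
    each blocked list has at least \<open>b\<close> clique vertices with a different list.\<close>
  define c where "c = c0(p := y)"
  have c: "\<forall>i<a. c i \<in> A i" and yc: "y \<in> c ` {..<a}"
    using c0 y p by (auto simp: c_def)
  \<comment> \<open>The first \<open>m\<close> lists are unblocked one by one, each at the cost of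
    at most one clique vertex.\<close>
  have "\<exists>I d. I \<subseteq> {..<?n} \<and> card I \<le> m \<and> inj_on d I \<and> (\<forall>i\<in>I. d i \<in> D i) \<and>
      d ` I \<inter> c ` {..<a} = {} \<and> (\<forall>j<m. \<not> d ` I \<union> c ` {..<a} \<subseteq> B j)" if "m \<le> b" for m
    using that
  proof (induction m)
    case 0
    show ?case by (intro exI[of _ "{}"]) simp
  next
    case (Suc m)
    then obtain I d where I: "I \<subseteq> {..<?n}" "card I \<le> m" "inj_on d I" "\<forall>i\<in>I. d i \<in> D i"
      "d ` I \<inter> c ` {..<a} = {}" and sat: "\<forall>j<m. \<not> d ` I \<union> c ` {..<a} \<subseteq> B j"
      by auto
    show ?case
    proof (cases "d ` I \<union> c ` {..<a} \<subseteq> B m")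
      case False
      then show ?thesis using I sat
        by (intro exI[of _ I] exI[of _ d]) (auto simp: less_Suc_eq)
    next
      case True
      \<comment> \<open>At most \<open>m < b\<close> clique vertices are coloured, so one whose list
        differs from \<open>B m\<close> is still free.\<close>
      then have "B m \<noteq> M" using yc y by blast
      then have "card I < card {i \<in> {..<?n}. D i \<noteq> B m}"
        using M(3) I(2) Suc.prems by (fastforce simp: cnt_def)
      moreover have "finite I" using I(1) finite_subset by blast
      ultimately have "\<not> {i \<in> {..<?n}. D i \<noteq> B m} \<subseteq> I"
        using card_mono by (metis linorder_not_less)
      then obtain i where i: "i < ?n" "D i \<noteq> B m" "i \<notin> I" by blast
      \<comment> \<open>Distinct lists of equal size are not nested. As \<open>B m\<close> contains
        all used colours, \<open>x\<close> is new and unblocks it.\<close>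
      then obtain x where x: "x \<in> D i" "x \<notin> B m"
        using D B Suc.prems by (metis Suc_le_eq card_subset_eq subsetI)
      show ?thesis
      proof (intro exI[of _ "insert i I"] exI[of _ "d(i := x)"] conjI)
        have "finite I" using I(1) finite_subset by blast
        then show "card (insert i I) \<le> Suc m" using I(2) by (simp add: card_insert_if)
        have im: "(d(i := x)) ` insert i I = insert x (d ` I)" using i(3) by auto
        show "(d(i := x)) ` insert i I \<inter> c ` {..<a} = {}"
          unfolding im using I(5) True x(2) by blast
        show "\<forall>j<Suc m. \<not> (d(i := x)) ` insert i I \<union> c ` {..<a} \<subseteq> B j"
          unfolding im using sat x(2) by (auto simp: less_Suc_eq)
        show "inj_on (d(i := x)) (insert i I)"
          using I(3) i(3) True x(2) by (auto simp: inj_on_def)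
      qed (use I i x in auto)
    qed
  qed
  from this[OF order_refl] obtain I d where I: "I \<subseteq> {..<?n}" "inj_on d I" "\<forall>i\<in>I. d i \<in> D i"
    "d ` I \<inter> c ` {..<a} = {}" and sat: "\<forall>j<b. \<not> d ` I \<union> c ` {..<a} \<subseteq> B j"
    by auto
  have "card (c ` {..<a}) + ?n \<le> ?k" using card_image_le[of "{..<a}" c] by simp
  \<comment> \<open>Colouring the rest of the clique only adds colours, so unblocked lists stay
    unblocked.\<close>
  then obtain d' where d': "partial_list_coloring ?n a D A d' c" "\<forall>i\<in>I. d' i = d i"
    using partial_list_coloring_extend[OF D c I] by blast
  then have "d ` I = d' ` I" by (intro image_cong) simp_all
  also have "\<dots> \<subseteq> d' ` {..<?n}" using I(1) by (rule image_mono)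
  finally have "\<forall>j<b. B j \<noteq> d' ` {..<?n} \<union> c ` {..<a}" using sat by (metis Un_mono order_refl)
  with d'(1) show "\<exists>d c. partial_list_coloring ?n a D A d c \<and>
      (\<forall>j<b. B j \<noteq> d ` {..<?n} \<union> c ` {..<a})" by blast
qed

section \<open>Reading off when the value of \<open>tau\<close> is 1\<close>

theorem theorem12:
  fixes s b :: nat
  assumes "b \<ge> 1"
  shows "tau s (s + 2) b = 1 \<longleftrightarrow>
         (s + 2) ^ (s + 2) \<le> b \<and> b \<le> ((s + 3) choose 2) * (s + 3) ^ (s + 1) - 1"
proof -
  \<comment> \<open>The chromatic number is \<open>n + 2\<close>, so a difference of at most
    \<open>s\<close> means that lists of size \<open>n + (s + 2)\<close> suffice.\<close>
  define P where "P n \<longleftrightarrow> choosable (join_Kn_Kab n (s + 2) b) (n + (s + 2))" for n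
  have "(int (list_chromatic_number (join_Kn_Kab n (s + 2) b))
      - int (chromatic_number (join_Kn_Kab n (s + 2) b)) \<le> int s) \<longleftrightarrow> P n" for n
    using list_chromatic_number_le_iff[OF choosable_join_Kn_Kab_greedy[of n "s + 2" b],
        of "n + (s + 2)"] assms
    by (auto simp: chromatic_number_join_Kn_Kab P_def)
  then have tau: "tau s (s + 2) b = (LEAST n. P n)" by (simp add: tau_def)
  have ex: "P (2 * b)" unfolding P_def by (rule choosable_join_Kn_Kab_large) simp
  have "(LEAST n. P n) = 1 \<longleftrightarrow> \<not> P 0 \<and> P 1"
  proof
    assume L: "(LEAST n. P n) = 1"
    then show "\<not> P 0 \<and> P 1" using LeastI[of P, OF ex] not_less_Least[of 0 P] by simp
  next
    assume "\<not> P 0 \<and> P 1"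
    then show "(LEAST n. P n) = 1"
      by (intro Least_equality) (auto simp: Suc_le_eq intro: gr0I)
  qed
  moreover have "P 0 \<longleftrightarrow> b < (s + 2) ^ (s + 2)"
    using choosable_Kab[of b "s + 2"] not_choosable_Kab[of "s + 2" b]
    unfolding P_def by linarith
  moreover have "P 1 \<longleftrightarrow> b < ((s + 3) choose 2) * (s + 3) ^ (s + 1)"
    using choosable_K1_Kab[of "s + 2" b] not_choosable_K1_Kab[of "s + 2" b]
    unfolding P_def by (simp add: numeral_3_eq_3) linarith
  \<comment> \<open>Positivity makes \<open>b < N\<close> and \<open>b \<le> N - 1\<close>
    equivalent for this product \<open>N\<close> under truncated subtraction.\<close>
  moreover have "((s + 3) choose 2) * (s + 3) ^ (s + 1) > 0"
    by (simp add: zero_less_binomial_iff)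
  ultimately show ?thesis unfolding tau by linarith
qed

end
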